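(* Let $\dot A$ be a closed, densely defined symmetric operator with deficiency indices $(1,1)$ in a Hilbert space, let $A$ be a self-adjoint extension of $\dot A$, and let $\widehat A\neq(\widehat A)^*$ be a maximal dissipative extension of $\dot A$. Suppose that $g_\pm\in\operatorname{Ker}((\dot A)^*\mp iI)$, $\|g_\pm\|=1$, and that $$g_+-g_-\in\operatorname{Dom}(A)\quad\text{and}\quad g_+-\kappa g_-\in\operatorname{Dom}(\widehat A)\ \text{ for some } |\kappa|<1 .$$ Let $s=s(\dot A,A)$ be the Livšic function of the pair $(\dot A,A)$ and $\mathcal M=\mathcal M(\widehat A)$ the Weyl–Titchmarsh function of $\widehat A$. Then $$\overline{\kappa}\,s(z)=\frac{\mathcal M(z)-i}{\mathcal M(z)+i},\qquad z\in\mathbb C_+ .$$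
   Context: $\mathbb C_+$ is the open upper half-plane; inner products are linear in the first argument. A maximal dissipative extension $\widehat A$ of $\dot A$ is a maximal operator extending $\dot A$ with $\operatorname{Im}(\widehat Af,f)\ge 0$ for $f\in\operatorname{Dom}(\widehat A)$; it satisfies $\dot A\subset\widehat A\subset(\dot A)^*$. Livšic function of $(\dot A,A)$: with $g_\pm\in\operatorname{Ker}((\dot A)^*\mp iI)$, $\|g_\pm\|=1$, $g_+-g_-\in\operatorname{Dom}(A)$, $$s(z)=\frac{z-i}{z+i}\cdot\frac{(g_z,g_-)}{(g_z,g_+)},\quad z\in\mathbb C_+,$$ where $0\ne g_z\in\operatorname{Ker}((\dot A)^*-zI)$ is arbitrary. Weyl–Titchmarsh function of the dissipative extension $\widehat A$ of $\dot A$: $$\mathcal M(z)=\left(((\widehat A)^*z+I)((\widehat A)^*-zI)^{-1}g_+,g_+\right),\quad z\in\mathbb C_+,$$ where $g_+\in\operatorname{Ker}((\dot A)^*-iI)$, $\|g_+\|=1$. *)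

theory Defs
  imports "HOL-Analysis.Analysis"
begin

section \<open>Complex Hilbert spaces\<close>

text \<open>The inner product is linear in the first argument. Together with the axioms of
  \<^class>\<open>real_normed_vector\<close>, the axiom \<open>cinner_self\<close> yields positive definiteness and says that
  the norm is the one induced by the inner product.\<close>

class complex_inner_space = real_normed_vector +
  fixes scaleC :: "complex \<Rightarrow> 'a \<Rightarrow> 'a"  (infixr "*\<^sub>C" 75)
    and cinner :: "'a \<Rightarrow> 'a \<Rightarrow> complex"
  assumes scaleC_add_right: "a *\<^sub>C (x + y) = a *\<^sub>C x + a *\<^sub>C y"
    and scaleC_add_left: "(a + b) *\<^sub>C x = a *\<^sub>C x + b *\<^sub>C x"
    and scaleC_scaleC: "a *\<^sub>C (b *\<^sub>C x) = (a * b) *\<^sub>C x"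
    and scaleC_one: "1 *\<^sub>C x = x"
    and scaleR_scaleC: "scaleR r x = complex_of_real r *\<^sub>C x"
    and cinner_add_left: "cinner (x + y) w = cinner x w + cinner y w"
    and cinner_scaleC_left: "cinner (a *\<^sub>C x) w = a * cinner x w"
    and cinner_commute: "cinner x y = cnj (cinner y x)"
    and cinner_self: "cinner x x = complex_of_real ((norm x)\<^sup>2)"

class complex_hilbert_space = complex_inner_space + complete_space

lemma vector_space_scaleC:
  "vector_space (scaleC :: complex \<Rightarrow> 'a::complex_inner_space \<Rightarrow> 'a)"
  by unfold_locales
    (simp_all add: scaleC_add_right scaleC_add_left scaleC_scaleC scaleC_one)

section \<open>Unbounded operators\<close>

text \<open>An operator with domain a linear subspace is identified with its graph. Its domain is
  \<^const>\<open>Domain\<close>, extension of operators is inclusion of graphs, closedness is closedness of the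
  graph in the product space, and the inverse of an injective operator is the converse relation.\<close>

type_synonym 'a unbounded_op = "('a \<times> 'a) set"

definition linear_op :: "'a::complex_inner_space unbounded_op \<Rightarrow> bool" where
  "linear_op T \<longleftrightarrow> single_valued T \<and> (0, 0) \<in> T \<and>
     (\<forall>x u y v. (x, u) \<in> T \<longrightarrow> (y, v) \<in> T \<longrightarrow> (x + y, u + v) \<in> T) \<and>
     (\<forall>c x u. (x, u) \<in> T \<longrightarrow> (c *\<^sub>C x, c *\<^sub>C u) \<in> T)"

definition op_apply :: "'a unbounded_op \<Rightarrow> 'a \<Rightarrow> 'a" where
  "op_apply T x = (THE y. (x, y) \<in> T)"

text \<open>The operator \<open>aT + bI\<close> on the domain of \<open>T\<close>.\<close>

definition op_affine ::
    "complex \<Rightarrow> 'a::complex_inner_space unbounded_op \<Rightarrow> complex \<Rightarrow> 'a unbounded_op" where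
  "op_affine a T b = {(x, a *\<^sub>C y + b *\<^sub>C x) | x y. (x, y) \<in> T}"

definition op_ker :: "'a::zero unbounded_op \<Rightarrow> 'a set" where
  "op_ker T = {x. (x, 0) \<in> T}"

definition densely_defined :: "'a::topological_space unbounded_op \<Rightarrow> bool" where
  "densely_defined T \<longleftrightarrow> closure (Domain T) = UNIV"

text \<open>For densely defined \<open>T\<close> this relation is single-valued, i.e. the graph of an operator.\<close>

definition adjoint_op :: "'a::complex_inner_space unbounded_op \<Rightarrow> 'a unbounded_op" where
  "adjoint_op T = {(y, w). \<forall>(x, u) \<in> T. cinner u y = cinner x w}"

definition symmetric_op :: "'a::complex_inner_space unbounded_op \<Rightarrow> bool" where
  "symmetric_op T \<longleftrightarrow> linear_op T \<and>
     (\<forall>(x, u) \<in> T. \<forall>(y, v) \<in> T. cinner u y = cinner x v)"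

definition self_adjoint_op :: "'a::complex_inner_space unbounded_op \<Rightarrow> bool" where
  "self_adjoint_op T \<longleftrightarrow> linear_op T \<and> densely_defined T \<and> adjoint_op T = T"

definition dissipative_op :: "'a::complex_inner_space unbounded_op \<Rightarrow> bool" where
  "dissipative_op T \<longleftrightarrow> linear_op T \<and> (\<forall>(f, u) \<in> T. 0 \<le> Im (cinner u f))"

definition maximal_dissipative_extension ::
    "'a::complex_inner_space unbounded_op \<Rightarrow> 'a unbounded_op \<Rightarrow> bool" where
  "maximal_dissipative_extension S T \<longleftrightarrow> S \<subseteq> T \<and> dissipative_op T \<and>
     (\<forall>T'. dissipative_op T' \<and> T \<subseteq> T' \<longrightarrow> T' = T)"

text \<open>\<open>Ker (T\<^sup>* - zI)\<close>\<close>

definition defect_space :: "'a::complex_inner_space unbounded_op \<Rightarrow> complex \<Rightarrow> 'a set" where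
  "defect_space T z = op_ker (op_affine 1 (adjoint_op T) (- z))"

text \<open>Complex dimensions; the value 0 of \<open>vector_space.dim\<close> also covers infinite dimension.\<close>

definition deficiency_indices :: "'a::complex_inner_space unbounded_op \<Rightarrow> nat \<times> nat" where
  "deficiency_indices T =
     (vector_space.dim scaleC (defect_space T \<i>), vector_space.dim scaleC (defect_space T (- \<i>)))"

section \<open>The Livsic function and the Weyl-Titchmarsh function\<close>

text \<open>Both functions do not depend on the admissible choices of \<open>g\<^sub>+\<close>, \<open>g\<^sub>-\<close> and \<open>g\<^sub>z\<close>;
  the definite descriptions denote the common value of all these choices, for \<open>z\<close> in the open
  upper half-plane.\<close>

definition livsic_function ::
    "'a::complex_inner_space unbounded_op \<Rightarrow> 'a unbounded_op \<Rightarrow> complex \<Rightarrow> complex" where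
  "livsic_function S A z = (THE w. \<exists>gp gm gz.
     gp \<in> defect_space S \<i> \<and> norm gp = 1 \<and>
     gm \<in> defect_space S (- \<i>) \<and> norm gm = 1 \<and>
     gp - gm \<in> Domain A \<and>
     gz \<in> defect_space S z \<and> gz \<noteq> 0 \<and>
     w = (z - \<i>) / (z + \<i>) * (cinner gz gm / cinner gz gp))"

text \<open>The relational composition \<open>r O s\<close> applies \<open>r\<close> first.\<close>

definition weyl_titchmarsh_function ::
    "'a::complex_inner_space unbounded_op \<Rightarrow> 'a unbounded_op \<Rightarrow> complex \<Rightarrow> complex" where
  "weyl_titchmarsh_function S T z = (THE w. \<exists>gp.
     gp \<in> defect_space S \<i> \<and> norm gp = 1 \<and>
     w = cinner (op_apply ((op_affine 1 (adjoint_op T) (- z))\<inverse> O op_affine z (adjoint_op T) 1) gp) gp)"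

end

theory Submission
  imports Defs
begin

text \<open>
  Write \<open>S\<close> for the symmetric operator, \<open>T\<close> for its dissipative extension, and
  \<open>[p, q] = (u, y) - (x, v)\<close> for the boundary form of two pairs \<open>p = (x, u)\<close>, \<open>q = (y, v)\<close>.
  The adjoint of a graph is its orthogonal complement under this form, so everything in the
  theorem can be read off from the form on the graph of \<open>S\<^sup>*\<close>. Two coordinates describe it there:
  \<open>\<alpha>(p) = [p, P] / 2\<i>\<close> and \<open>\<beta>(p) = - [p, N] / 2\<i>\<close>, where \<open>P\<close> and \<open>N\<close> are the points of the
  graph of \<open>S\<^sup>*\<close> over \<open>g\<^sub>+\<close> and \<open>g\<^sub>-\<close>. They satisfy the Lagrange identity
  (\<open>Lagrange_identity\<close>)
  \<open>[p, q] = 2\<i> (\<alpha>(p) cnj \<alpha>(q) - \<beta>(p) cnj \<beta>(q))\<close>, because every \<open>p\<close> in \<open>S\<^sup>*\<close> is the sum of a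
  point of the self-adjoint operator \<open>A\<close>, on which the form vanishes, and a multiple of \<open>P\<close>.
  This decomposition needs the surjectivity of \<open>A - \<i>\<close>, which comes from the projection
  theorem.

  In these coordinates the operators become linear relations: \<open>\<beta> = - \<alpha>\<close> on \<open>A\<close>,
  \<open>\<beta> = - \<kappa> \<alpha>\<close> on \<open>T\<close>, and \<open>T\<^sup>*\<close> is the part of \<open>S\<^sup>*\<close> where
  \<open>\<alpha> = - cnj \<kappa> \<beta>\<close>. For an eigenvector \<open>g\<close> of \<open>S\<^sup>*\<close> at \<open>z\<close> in the upper half-plane the Lagrange
  identity reads \<open>Im z |g|\<^sup>2 = |\<alpha>|\<^sup>2 - |\<beta>|\<^sup>2\<close>. Hence \<open>\<alpha> \<noteq> 0\<close> unless \<open>g = 0\<close>, and the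
  Livsic function is \<open>s(z) = - \<beta>(g) / \<alpha>(g)\<close> for any \<open>g \<noteq> 0\<close>.

  Let now \<open>x = (T\<^sup>* - z)\<^sup>-\<^sup>1 g\<^sub>+\<close>. Expanding the definition gives
  \<open>M(z) = \<i> + 2\<i> (z - \<i>) \<alpha>(x)\<close>. On the other hand \<open>g = g\<^sub>+ + (z - \<i>) x\<close> is an eigenvector of \<open>S\<^sup>*\<close>
  at \<open>z\<close> with \<open>\<alpha>(g) = 1 + (z - \<i>) \<alpha>(x)\<close> and \<open>\<beta>(g) = (z - \<i>) \<beta>(x)\<close>. Since
  \<open>\<alpha>(x) = - cnj \<kappa> \<beta>(x)\<close>, both sides of the claim equal
  \<open>(z - \<i>) \<alpha>(x) / (1 + (z - \<i>) \<alpha>(x))\<close>.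
\<close>

section \<open>Inner product geometry\<close>

interpretation cvs: vector_space "scaleC :: complex \<Rightarrow> 'a::complex_inner_space \<Rightarrow> 'a"
  by (rule vector_space_scaleC)

lemma cinner_add_right: "cinner x (y + w) = cinner x y + cinner x w"
  by (metis cinner_add_left cinner_commute complex_cnj_add)

lemma cinner_scaleC_right: "cinner x (a *\<^sub>C y) = cnj a * cinner x y"
  by (metis cinner_scaleC_left cinner_commute complex_cnj_mult)

lemma cinner_minus_left: "cinner (- x) y = - cinner x y"
  using cinner_scaleC_left[of "-1" x y] by simp

lemma cinner_minus_right: "cinner x (- y) = - cinner x y"
  using cinner_scaleC_right[of x "-1" y] by simp

lemma cinner_diff_left: "cinner (x - y) w = cinner x w - cinner y w"
  using cinner_add_left[of x "- y" w] by (simp add: cinner_minus_left)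

lemma cinner_diff_right: "cinner x (y - w) = cinner x y - cinner x w"
  using cinner_add_right[of x y "- w"] by (simp add: cinner_minus_right)

lemma cinner_zero_left: "cinner 0 x = 0"
  using cinner_scaleC_left[of 0 0 x] by simp

lemma cinner_zero_right: "cinner x 0 = 0"
  using cinner_scaleC_right[of x 0 0] by simp

lemmas cinner_simps = cinner_add_left cinner_add_right cinner_scaleC_left cinner_scaleC_right
  cinner_minus_left cinner_minus_right cinner_diff_left cinner_diff_right
  cinner_zero_left cinner_zero_right

lemma cinner_self_eq_0_iff: "cinner x x = 0 \<longleftrightarrow> x = 0"
  by (simp add: cinner_self)

lemma norm_scaleC: "norm (a *\<^sub>C x) = cmod a * norm x"
proof -
  have "cinner (a *\<^sub>C x) (a *\<^sub>C x) = complex_of_real ((cmod a * norm x)\<^sup>2)"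
    unfolding cinner_scaleC_left cinner_scaleC_right power_mult_distrib of_real_mult
      complex_norm_square cinner_self[of x]
    by (simp only: mult_ac)
  then have "complex_of_real ((norm (a *\<^sub>C x))\<^sup>2) = complex_of_real ((cmod a * norm x)\<^sup>2)"
    by (simp only: cinner_self)
  then have "(norm (a *\<^sub>C x))\<^sup>2 = (cmod a * norm x)\<^sup>2"
    using of_real_eq_iff by blast
  then show ?thesis by simp
qed

text \<open>Pythagoras for the component of \<open>x\<close> orthogonal to \<open>y\<close>. The sign of the left-hand side gives
  the Cauchy-Schwarz inequality, and a nearest point of a subspace must make the subtracted term
  vanish.\<close>

lemma norm_minus_projection_sq:
  assumes "y \<noteq> 0"
  shows "(norm (x - (cinner x y / cinner y y) *\<^sub>C y))\<^sup>2
    = (norm x)\<^sup>2 - (cmod (cinner x y))\<^sup>2 / (norm y)\<^sup>2"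
proof -
  have yy: "cinner y y \<noteq> 0"
    using assms by (simp add: cinner_self_eq_0_iff)
  have "cinner (x - (cinner x y / cinner y y) *\<^sub>C y) (x - (cinner x y / cinner y y) *\<^sub>C y)
      = cinner x x - cinner x y * cnj (cinner x y) / cinner y y"
    using yy cinner_commute[of y x] by (simp add: cinner_simps field_simps)
  then have "complex_of_real ((norm (x - (cinner x y / cinner y y) *\<^sub>C y))\<^sup>2)
    = complex_of_real ((norm x)\<^sup>2 - (cmod (cinner x y))\<^sup>2 / (norm y)\<^sup>2)"
    unfolding cinner_self by (simp add: complex_norm_square[symmetric])
  then show ?thesis
    using of_real_eq_iff by blast
qed

lemma cinner_Cauchy_Schwarz: "cmod (cinner x y) \<le> norm x * norm y"
proof (cases "y = 0")
  case False
  have "0 \<le> (norm x)\<^sup>2 - (cmod (cinner x y))\<^sup>2 / (norm y)\<^sup>2"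
    using norm_minus_projection_sq[OF False, of x] by (metis zero_le_power2)
  then have "(cmod (cinner x y))\<^sup>2 \<le> (norm x * norm y)\<^sup>2"
    using False by (simp add: power_mult_distrib pos_divide_le_eq)
  then show ?thesis
    by (rule power2_le_imp_le) simp
qed (simp add: cinner_zero_right)

lemma bounded_bilinear_cinner: "bounded_bilinear (cinner :: 'a::complex_inner_space \<Rightarrow> _)"
proof
  show "\<exists>K. \<forall>(x::'a) y. norm (cinner x y) \<le> norm x * norm y * K"
    using cinner_Cauchy_Schwarz by (metis mult.right_neutral)
qed (simp_all add: cinner_simps scaleR_scaleC scaleR_conv_of_real)

lemma parallelogram_law:
  fixes x y :: "'a::complex_inner_space"
  shows "(norm (x + y))\<^sup>2 + (norm (x - y))\<^sup>2 = 2 * (norm x)\<^sup>2 + 2 * (norm y)\<^sup>2"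
proof -
  have "cinner (x + y) (x + y) + cinner (x - y) (x - y) = 2 * cinner x x + 2 * cinner y y"
    by (simp add: cinner_simps)
  then have "complex_of_real ((norm (x + y))\<^sup>2 + (norm (x - y))\<^sup>2)
    = complex_of_real (2 * (norm x)\<^sup>2 + 2 * (norm y)\<^sup>2)"
    by (simp add: cinner_self)
  then show ?thesis
    using of_real_eq_iff by blast
qed

lemma closed_subspace_nearest_point:
  fixes M :: "'a::complex_hilbert_space set"
  assumes sub: "cvs.subspace M" and cl: "closed M"
  shows "\<exists>m\<in>M. \<forall>k\<in>M. norm (y - m) \<le> norm (y - k)"
proof -
  have ne: "M \<noteq> {}"
    using cvs.subspace_0[OF sub] by blast
  define d where "d = infdist y M"
  have d: "d \<le> norm (y - k)" if "k \<in> M" for k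
    using infdist_le[OF that, of y] by (simp add: d_def dist_norm)
  have d0: "0 \<le> d"
    by (simp add: d_def infdist_nonneg)
  have "\<exists>k\<in>M. norm (y - k) < d + inverse (real (Suc n))" for n
  proof -
    have "(INF k\<in>M. dist y k) < d + inverse (real (Suc n))"
      using ne by (simp add: d_def infdist_notempty)
    then show ?thesis
      using ne by (subst (asm) cINF_less_iff) (auto simp: dist_norm intro: bdd_belowI2[of _ 0])
  qed
  then obtain k where kM: "\<And>n. k n \<in> M"
    and kd: "\<And>n. norm (y - k n) < d + inverse (real (Suc n))"
    by metis
  have lim: "(\<lambda>n. norm (y - k n)) \<longlonglongrightarrow> d"
  proof (rule tendsto_sandwich[of "\<lambda>_. d"])
    show "\<forall>\<^sub>F n in sequentially. d \<le> norm (y - k n)"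
      using d kM by simp
    show "\<forall>\<^sub>F n in sequentially. norm (y - k n) \<le> d + inverse (real (Suc n))"
      using kd by (simp add: less_imp_le)
    show "(\<lambda>n. d + inverse (real (Suc n))) \<longlonglongrightarrow> d"
      using tendsto_add[OF tendsto_const LIMSEQ_inverse_real_of_nat, of d] by simp
  qed simp
  \<comment> \<open>The midpoint of two points of the sequence stays at distance at least \<open>d\<close> from \<open>y\<close>, so the
    parallelogram law bounds the distance of the two points.\<close>
  have close: "(norm (k m - k n))\<^sup>2 \<le> 2 * ((norm (y - k m))\<^sup>2 - d\<^sup>2) + 2 * ((norm (y - k n))\<^sup>2 - d\<^sup>2)"
    for m n
  proof -
    define c where "c = (1/2::complex) *\<^sub>C (k m + k n)"
    have "c \<in> M"
      unfolding c_def using sub kM by (simp add: cvs.subspace_add cvs.subspace_scale)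
    then have "d \<le> norm (y - c)"
      by (rule d)
    moreover have "(y - k m) + (y - k n) = (2::complex) *\<^sub>C (y - c)"
    proof -
      have "(2::complex) *\<^sub>C y = y + y"
        using cvs.scale_left_distrib[of 1 1 y] by simp
      then show ?thesis
        by (simp add: c_def cvs.scale_right_diff_distrib algebra_simps)
    qed
    ultimately have "2 * d \<le> norm ((y - k m) + (y - k n))"
      by (simp add: norm_scaleC)
    then have "(2 * d)\<^sup>2 \<le> (norm ((y - k m) + (y - k n)))\<^sup>2"
      using d0 by (intro power_mono) auto
    moreover have "norm ((y - k m) - (y - k n)) = norm (k m - k n)"
      by (simp add: norm_minus_commute)
    ultimately show ?thesis
      using parallelogram_law[of "y - k m" "y - k n"] by (simp add: power_mult_distrib)
  qed
  have "Cauchy k"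
  proof (rule metric_CauchyI)
    fix e :: real assume "0 < e"
    have "(\<lambda>n. (norm (y - k n))\<^sup>2 - d\<^sup>2) \<longlonglongrightarrow> d\<^sup>2 - d\<^sup>2"
      by (intro tendsto_intros lim)
    then have "\<forall>\<^sub>F n in sequentially. (norm (y - k n))\<^sup>2 - d\<^sup>2 < e\<^sup>2 / 4"
      using \<open>0 < e\<close> by (intro order_tendstoD(2)[where y = 0]) auto
    then obtain N where N: "\<And>n. n \<ge> N \<Longrightarrow> (norm (y - k n))\<^sup>2 - d\<^sup>2 < e\<^sup>2 / 4"
      by (auto simp: eventually_sequentially)
    have "dist (k m) (k n) < e" if "m \<ge> N" "n \<ge> N" for m n
    proof -
      have "(norm (k m - k n))\<^sup>2 < e\<^sup>2"
        using close[of m n] N[OF that(1)] N[OF that(2)] by simp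
      then show ?thesis
        unfolding dist_norm by (rule power2_less_imp_less) (use \<open>0 < e\<close> in simp)
    qed
    then show "\<exists>N. \<forall>m\<ge>N. \<forall>n\<ge>N. dist (k m) (k n) < e"
      by blast
  qed
  then obtain l where l: "k \<longlonglongrightarrow> l"
    using Cauchy_convergent convergent_def by blast
  have "l \<in> M"
    using closed_sequentially[OF cl] kM l by blast
  moreover have "norm (y - l) = d"
    by (rule LIMSEQ_unique[OF _ lim]) (intro tendsto_intros l)
  ultimately show ?thesis
    using d by auto
qed

text \<open>The difference of \<open>y\<close> and its nearest point in \<open>M\<close> is orthogonal to \<open>M\<close>: removing its
  component along some \<open>k \<in> M\<close> would shorten it.\<close>

lemma closed_subspace_eq_UNIV:
  fixes M :: "'a::complex_hilbert_space set"
  assumes sub: "cvs.subspace M" and cl: "closed M"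
    and orth: "\<And>n. (\<And>m. m \<in> M \<Longrightarrow> cinner m n = 0) \<Longrightarrow> n = 0"
  shows "M = UNIV"
proof -
  have "y \<in> M" for y
  proof -
    obtain m where m: "m \<in> M" and min: "\<And>k. k \<in> M \<Longrightarrow> norm (y - m) \<le> norm (y - k)"
      using closed_subspace_nearest_point[OF sub cl] by blast
    have "cinner k (y - m) = 0" if k: "k \<in> M" for k
    proof (cases "k = 0")
      case False
      define c where "c = cinner (y - m) k / cinner k k"
      have "m + c *\<^sub>C k \<in> M"
        using sub m k by (simp add: cvs.subspace_add cvs.subspace_scale)
      then have "norm (y - m) \<le> norm ((y - m) - c *\<^sub>C k)"
        using min[of "m + c *\<^sub>C k"] by (simp add: diff_diff_eq)
      then have "(norm (y - m))\<^sup>2 \<le> (norm ((y - m) - c *\<^sub>C k))\<^sup>2"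
        by (intro power_mono) auto
      then have "(cmod (cinner (y - m) k))\<^sup>2 / (norm k)\<^sup>2 \<le> 0"
        using norm_minus_projection_sq[OF False, of "y - m"] by (simp add: c_def)
      then have "cinner (y - m) k = 0"
        using False by (simp add: divide_le_0_iff)
      then show ?thesis
        by (metis cinner_commute complex_cnj_zero)
    qed (simp add: cinner_zero_left)
    then have "y - m = 0"
      by (rule orth)
    then show ?thesis
      using m by simp
  qed
  then show ?thesis by blast
qed

lemma one_dimensional_multiple:
  fixes V :: "'a::complex_inner_space set"
  assumes "cvs.dim V = 1" and "g \<in> V" and "g \<noteq> 0" and "h \<in> V"
  shows "\<exists>c. h = c *\<^sub>C g"
proof -
  obtain B where "V \<subseteq> cvs.span B" and "card B = cvs.dim V"
    by (rule cvs.basis_exists)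
  then obtain v where "V \<subseteq> cvs.span {v}"
    using assms(1) by (metis One_nat_def card_1_singletonE)
  then obtain a b where "g = a *\<^sub>C v" "h = b *\<^sub>C v"
    using assms(2,4) unfolding cvs.span_singleton by blast
  then have "h = (b / a) *\<^sub>C g"
    using assms(3) by auto
  then show ?thesis ..
qed

section \<open>The boundary form\<close>

definition pscale :: "complex \<Rightarrow> 'a::complex_inner_space \<times> 'a \<Rightarrow> 'a \<times> 'a" where
  "pscale c p = (c *\<^sub>C fst p, c *\<^sub>C snd p)"

lemma linear_op_add: "linear_op T \<Longrightarrow> p \<in> T \<Longrightarrow> q \<in> T \<Longrightarrow> p + q \<in> T"
  by (cases p; cases q) (simp add: linear_op_def)

lemma linear_op_pscale: "linear_op T \<Longrightarrow> p \<in> T \<Longrightarrow> pscale c p \<in> T"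
  by (cases p) (simp add: linear_op_def pscale_def)

definition boundary_form :: "'a::complex_inner_space \<times> 'a \<Rightarrow> 'a \<times> 'a \<Rightarrow> complex" where
  "boundary_form p q = cinner (snd p) (fst q) - cinner (fst p) (snd q)"

lemma boundary_form_simps:
  "boundary_form (p + p') q = boundary_form p q + boundary_form p' q"
  "boundary_form p (q + q') = boundary_form p q + boundary_form p q'"
  "boundary_form (p - p') q = boundary_form p q - boundary_form p' q"
  "boundary_form p (q - q') = boundary_form p q - boundary_form p q'"
  "boundary_form (pscale c p) q = c * boundary_form p q"
  "boundary_form p (pscale c q) = cnj c * boundary_form p q"
  by (simp_all add: boundary_form_def pscale_def cinner_simps algebra_simps)

lemma boundary_form_commute: "boundary_form p q = - cnj (boundary_form q p)"
  using cinner_commute[of "fst p" "snd q"] cinner_commute[of "snd p" "fst q"]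
  by (simp add: boundary_form_def)

lemma Im_boundary_form_self: "Im (boundary_form (x, u) (x, u)) = 2 * Im (cinner u x)"
  using cinner_commute[of x u] by (simp add: boundary_form_def)

lemma boundary_form_eigenvector:
  "boundary_form (x, w *\<^sub>C x) (x, w *\<^sub>C x) = 2 * \<i> * of_real (Im w * (norm x)\<^sup>2)"
  by (simp add: boundary_form_def cinner_simps cinner_self complex_eq_iff)

lemma mem_adjoint_op: "q \<in> adjoint_op T \<longleftrightarrow> (\<forall>p\<in>T. boundary_form p q = 0)"
  by (auto simp: adjoint_op_def boundary_form_def case_prod_beta)

lemma adjoint_op_add: "p \<in> adjoint_op T \<Longrightarrow> q \<in> adjoint_op T \<Longrightarrow> p + q \<in> adjoint_op T"
  by (simp add: mem_adjoint_op boundary_form_simps)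

lemma adjoint_op_diff: "p \<in> adjoint_op T \<Longrightarrow> q \<in> adjoint_op T \<Longrightarrow> p - q \<in> adjoint_op T"
  by (simp add: mem_adjoint_op boundary_form_simps)

lemma adjoint_op_pscale: "p \<in> adjoint_op T \<Longrightarrow> pscale c p \<in> adjoint_op T"
  by (simp add: mem_adjoint_op boundary_form_simps)

lemma adjoint_op_antimono: "S \<subseteq> T \<Longrightarrow> adjoint_op T \<subseteq> adjoint_op S"
  unfolding subset_iff mem_adjoint_op by blast

lemma closed_adjoint_op:
  fixes T :: "'a::complex_inner_space unbounded_op"
  shows "closed (adjoint_op T)"
proof -
  have "adjoint_op T = (\<Inter>p\<in>T. {q. boundary_form p q = 0})"
    by (auto simp: mem_adjoint_op)
  moreover have "closed {q. boundary_form p q = 0}" for p :: "'a \<times> 'a"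
    unfolding boundary_form_def
    by (intro closed_Collect_eq continuous_intros
        bounded_bilinear.continuous_on[OF bounded_bilinear_cinner])
  ultimately show ?thesis
    by (simp add: closed_INT)
qed

lemma adjoint_op_unique:
  assumes "densely_defined T" and "(y, w) \<in> adjoint_op T" and "(y, w') \<in> adjoint_op T"
  shows "w = w'"
proof -
  have "closed {x. cinner x (w - w') = 0}"
    by (intro closed_Collect_eq continuous_intros
        bounded_bilinear.continuous_on[OF bounded_bilinear_cinner])
  moreover have "Domain T \<subseteq> {x. cinner x (w - w') = 0}"
  proof
    fix x assume "x \<in> Domain T"
    then obtain u where "(x, u) \<in> T" ..
    then have "boundary_form (x, u) ((y, w) - (y, w')) = 0"
      using adjoint_op_diff[OF assms(2,3)] unfolding mem_adjoint_op by blast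
    then show "x \<in> {x. cinner x (w - w') = 0}"
      by (simp add: boundary_form_def cinner_zero_right)
  qed
  ultimately have "closure (Domain T) \<subseteq> {x. cinner x (w - w') = 0}"
    by (rule closure_minimal[rotated])
  then have "cinner (w - w') (w - w') = 0"
    using assms(1) by (auto simp: densely_defined_def)
  then show ?thesis
    by (simp add: cinner_self_eq_0_iff)
qed

lemma mem_defect_space: "g \<in> defect_space T w \<longleftrightarrow> (g, w *\<^sub>C g) \<in> adjoint_op T"
  by (auto simp: defect_space_def op_ker_def op_affine_def)

text \<open>Divided by \<open>\<i>\<close>, the boundary form is Hermitian; it is nonnegative on \<open>T\<close> and vanishes on
  \<open>S\<close>. As for any semi-definite Hermitian form, null vectors are orthogonal to the whole space,
  so \<open>T\<close> is orthogonal to \<open>S\<close>.\<close>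

lemma dissipative_extension_subset_adjoint:
  assumes sym: "symmetric_op S" and diss: "dissipative_op T" and ext: "S \<subseteq> T"
  shows "T \<subseteq> adjoint_op S"
proof
  fix q assume q: "q \<in> T"
  have pos: "0 \<le> Im (boundary_form r r)" if "r \<in> T" for r
    using diss that by (cases r) (auto simp: dissipative_op_def Im_boundary_form_self)
  have "boundary_form p q = 0" if p: "p \<in> S" for p
  proof -
    define b where "b = boundary_form p q"
    have pp: "boundary_form p p = 0"
      using sym p unfolding symmetric_op_def boundary_form_def by (auto simp: case_prod_beta)
    \<comment> \<open>Along \<open>q - t p\<close> the imaginary part of the form is affine in \<open>t\<close>; for
      \<open>t = \<i> r cnj b\<close> it drops by \<open>2 r |b|\<^sup>2\<close>, for every real \<open>r\<close>.\<close>
    have "2 * r * (cmod b)\<^sup>2 \<le> Im (boundary_form q q)" for r :: real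
    proof -
      define t where "t = \<i> * of_real r * cnj b"
      have mem: "q + pscale (- t) p \<in> T"
        using diss q p ext unfolding dissipative_op_def
        by (blast intro: linear_op_add linear_op_pscale)
      have "boundary_form (q + pscale (- t) p) (q + pscale (- t) p)
          = boundary_form q q + (- t * b + cnj t * cnj b)"
        using boundary_form_commute[of q p]
        by (simp add: boundary_form_simps pp b_def)
      then have "Im (boundary_form (q + pscale (- t) p) (q + pscale (- t) p))
          = Im (boundary_form q q) + Im (- t * b + cnj t * cnj b)"
        by (simp only: plus_complex.sel)
      moreover have "Im (- t * b + cnj t * cnj b) = - (2 * r * (cmod b)\<^sup>2)"
        unfolding t_def cmod_power2 by (simp add: power2_eq_square algebra_simps)
      ultimately show ?thesis
        using pos[OF mem] by linarith
    qed
    from this[of "(Im (boundary_form q q) + 1) / (2 * (cmod b)\<^sup>2)"] have "b = 0"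
      by (cases "b = 0") simp_all
    then show ?thesis
      by (simp add: b_def)
  qed
  then show "q \<in> adjoint_op S"
    by (simp add: mem_adjoint_op)
qed

section \<open>Self-adjoint operators at non-real points\<close>

lemma self_adjoint_boundary_form:
  "self_adjoint_op A \<Longrightarrow> p \<in> A \<Longrightarrow> q \<in> A \<Longrightarrow> boundary_form p q = 0"
  using mem_adjoint_op[of q A] by (auto simp: self_adjoint_op_def)

lemma self_adjoint_lower_bound:
  assumes A: "self_adjoint_op A" and xu: "(x, u) \<in> A"
  shows "\<bar>Im w\<bar> * norm x \<le> norm (u - w *\<^sub>C x)"
proof (cases "x = 0")
  case False
  have "Im (cinner u x) = 0"
    using self_adjoint_boundary_form[OF A xu xu] Im_boundary_form_self[of x u] by simp
  then have "Im (cinner (u - w *\<^sub>C x) x) = - (Im w * (norm x)\<^sup>2)"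
    by (simp add: cinner_simps cinner_self)
  then have "\<bar>Im w\<bar> * (norm x)\<^sup>2 \<le> cmod (cinner (u - w *\<^sub>C x) x)"
    using abs_Im_le_cmod[of "cinner (u - w *\<^sub>C x) x"] by (simp add: abs_mult)
  also have "\<dots> \<le> norm (u - w *\<^sub>C x) * norm x"
    by (rule cinner_Cauchy_Schwarz)
  finally show ?thesis
    using False by (simp add: power2_eq_square)
qed simp

text \<open>The range of \<open>A - w\<close> is closed because the lower bound turns a convergent sequence of values
  into a Cauchy sequence of arguments and the graph of \<open>A\<close> is closed. A vector orthogonal to it
  is an eigenvector of \<open>A\<close> at \<open>cnj w\<close>, which is impossible for a nonzero vector since
  \<open>w\<close> is not real.\<close>

lemma self_adjoint_minus_nonreal_surj:
  fixes A :: "'a::complex_hilbert_space unbounded_op"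
  assumes A: "self_adjoint_op A" and w: "Im w \<noteq> 0"
  obtains x where "(x, y + w *\<^sub>C x) \<in> A"
proof -
  have lin: "linear_op A" and adj: "adjoint_op A = A"
    using A by (auto simp: self_adjoint_op_def)
  define R where "R = {u - w *\<^sub>C x | x u. (x, u) \<in> A}"
  have "R = UNIV"
  proof (rule closed_subspace_eq_UNIV)
    show "cvs.subspace R"
    proof (rule cvs.subspaceI)
      show "0 \<in> R"
        using lin unfolding linear_op_def R_def by (auto intro: exI[of _ 0])
      show "a + b \<in> R" if ab: "a \<in> R" "b \<in> R" for a b
      proof -
        obtain x u x' u' where "(x, u) \<in> A" "(x', u') \<in> A"
          and "a = u - w *\<^sub>C x" "b = u' - w *\<^sub>C x'"
          using ab by (auto simp: R_def)
        then have "(x + x', u + u') \<in> A" "a + b = (u + u') - w *\<^sub>C (x + x')"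
          using lin by (auto simp: linear_op_def cvs.scale_right_distrib)
        then show ?thesis
          by (auto simp: R_def)
      qed
      show "c *\<^sub>C a \<in> R" if a: "a \<in> R" for c a
      proof -
        obtain x u where "(x, u) \<in> A" "a = u - w *\<^sub>C x"
          using a by (auto simp: R_def)
        then have "(c *\<^sub>C x, c *\<^sub>C u) \<in> A" "c *\<^sub>C a = c *\<^sub>C u - w *\<^sub>C (c *\<^sub>C x)"
          using lin by (simp_all add: linear_op_def cvs.scale_right_diff_distrib mult.commute)
        then show ?thesis
          unfolding R_def by blast
      qed
    qed
    show "closed R"
      unfolding closed_sequential_limits
    proof (intro allI impI, elim conjE)
      fix r y assume "\<forall>n. r n \<in> R" and lim: "r \<longlonglongrightarrow> y"
      then obtain x where x: "\<And>n. (x n, r n + w *\<^sub>C x n) \<in> A"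
        unfolding R_def by (simp, metis diff_add_cancel)
      have bound: "\<bar>Im w\<bar> * norm (x m - x n) \<le> norm (r m - r n)" for m n
      proof -
        have "(x m, r m + w *\<^sub>C x m) - (x n, r n + w *\<^sub>C x n) \<in> A"
          using adjoint_op_diff[of _ A] x unfolding adj by blast
        from self_adjoint_lower_bound[OF A this[simplified], of w] show ?thesis
          by (simp add: cvs.scale_right_diff_distrib algebra_simps)
      qed
      have "Cauchy x"
      proof (rule metric_CauchyI)
        fix e :: real assume "0 < e"
        then have "0 < \<bar>Im w\<bar> * e"
          using w by simp
        then obtain N where N: "\<And>m n. m \<ge> N \<Longrightarrow> n \<ge> N \<Longrightarrow> dist (r m) (r n) < \<bar>Im w\<bar> * e"
          using LIMSEQ_imp_Cauchy[OF lim] metric_CauchyD by blast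
        have "dist (x m) (x n) < e" if "m \<ge> N" "n \<ge> N" for m n
        proof -
          have "\<bar>Im w\<bar> * norm (x m - x n) < \<bar>Im w\<bar> * e"
            using bound[of m n] N[OF that] by (simp add: dist_norm)
          then show ?thesis
            using w by (simp add: dist_norm)
        qed
        then show "\<exists>N. \<forall>m\<ge>N. \<forall>n\<ge>N. dist (x m) (x n) < e"
          by blast
      qed
      then obtain l where l: "x \<longlonglongrightarrow> l"
        using Cauchy_convergent convergent_def by blast
      have "bounded_linear (\<lambda>x::'a. w *\<^sub>C x)"
        by (rule bounded_linear_intro[where K = "cmod w"])
          (simp_all add: cvs.scale_right_distrib norm_scaleC scaleR_scaleC mult.commute)
      then have "(\<lambda>n. (x n, r n + w *\<^sub>C x n)) \<longlonglongrightarrow> (l, y + w *\<^sub>C l)"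
        by (intro tendsto_Pair tendsto_add lim l bounded_linear.tendsto[of "\<lambda>x. w *\<^sub>C x"])
      then have "(l, y + w *\<^sub>C l) \<in> A"
        using closed_sequentially[OF closed_adjoint_op[of A], of "\<lambda>n. (x n, r n + w *\<^sub>C x n)"] x
        unfolding adj by blast
      then show "y \<in> R"
        unfolding R_def by force
    qed
    show "n = 0" if orth: "\<And>m. m \<in> R \<Longrightarrow> cinner m n = 0" for n
    proof -
      have "(n, cnj w *\<^sub>C n) \<in> adjoint_op A"
        unfolding mem_adjoint_op
      proof
        fix p assume "p \<in> A"
        then have "snd p - w *\<^sub>C fst p \<in> R"
          unfolding R_def by (metis (mono_tags, lifting) mem_Collect_eq prod.collapse)
        from orth[OF this] show "boundary_form p (n, cnj w *\<^sub>C n) = 0"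
          by (simp add: boundary_form_def cinner_simps)
      qed
      then have "(n, cnj w *\<^sub>C n) \<in> A"
        by (simp add: adj)
      from self_adjoint_boundary_form[OF A this this] show "n = 0"
        using w by (simp add: boundary_form_eigenvector)
    qed
  qed
  then have "y \<in> R" by simp
  then obtain x u where "(x, u) \<in> A" "y = u - w *\<^sub>C x"
    by (auto simp: R_def)
  then show thesis
    using that[of x] by simp
qed

section \<open>Boundary coordinates\<close>

locale deficiency_one_extension =
  fixes S A :: "'a::complex_hilbert_space unbounded_op" and gp gm :: 'a
  assumes dense: "densely_defined S"
    and self_adjoint: "self_adjoint_op A" and extends: "S \<subseteq> A"
    and gp: "gp \<in> defect_space S \<i>" and norm_gp: "norm gp = 1"
    and gm: "gm \<in> defect_space S (- \<i>)" and norm_gm: "norm gm = 1"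
    and gp_spans: "\<And>g. g \<in> defect_space S \<i> \<Longrightarrow> \<exists>c. g = c *\<^sub>C gp"
    and gm_spans: "\<And>g. g \<in> defect_space S (- \<i>) \<Longrightarrow> \<exists>c. g = c *\<^sub>C gm"
    and gp_gm: "gp - gm \<in> Domain A"
begin

abbreviation "P \<equiv> (gp, \<i> *\<^sub>C gp)"
abbreviation "N \<equiv> (gm, - \<i> *\<^sub>C gm)"

text \<open>The coefficients of \<open>P\<close> and \<open>N\<close> in an element of \<open>S\<^sup>*\<close>, up to elements on which the boundary
  form is trivial: \<open>P\<close> and \<open>N\<close> are orthogonal under the form and
  \<open>[P, P] = 2\<i> = - [N, N]\<close>.\<close>

definition coord_plus :: "'a \<times> 'a \<Rightarrow> complex" where
  "coord_plus p = boundary_form p P / (2 * \<i>)"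

definition coord_minus :: "'a \<times> 'a \<Rightarrow> complex" where
  "coord_minus p = - boundary_form p N / (2 * \<i>)"

lemma coord_simps:
  "coord_plus (p + q) = coord_plus p + coord_plus q"
  "coord_plus (p - q) = coord_plus p - coord_plus q"
  "coord_plus (pscale c p) = c * coord_plus p"
  "coord_minus (p + q) = coord_minus p + coord_minus q"
  "coord_minus (p - q) = coord_minus p - coord_minus q"
  "coord_minus (pscale c p) = c * coord_minus p"
  by (simp_all add: coord_plus_def coord_minus_def boundary_form_simps field_simps)

lemma coord_defect:
  "coord_plus P = 1" "coord_minus P = 0" "coord_plus N = 0" "coord_minus N = 1"
  using norm_gp norm_gm
  by (simp_all add: coord_plus_def coord_minus_def boundary_form_def cinner_simps cinner_self)

lemma coord_eigenvector:
  "coord_plus (g, z *\<^sub>C g) = (z + \<i>) * cinner g gp / (2 * \<i>)"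
  "coord_minus (g, z *\<^sub>C g) = - (z - \<i>) * cinner g gm / (2 * \<i>)"
  by (simp_all add: coord_plus_def coord_minus_def boundary_form_def cinner_simps algebra_simps)

lemma P_adjoint: "P \<in> adjoint_op S" and N_adjoint: "N \<in> adjoint_op S"
  using gp gm by (simp_all only: mem_defect_space)

lemma A_subset_adjoint: "A \<subseteq> adjoint_op S"
  using adjoint_op_antimono[OF extends] self_adjoint by (simp add: self_adjoint_op_def)

text \<open>The hypothesis only puts \<open>g\<^sub>+ - g\<^sub>-\<close> into the domain of \<open>A\<close>; its image is forced because \<open>S\<^sup>*\<close>
  is single-valued.\<close>

lemma P_minus_N_mem: "P - N \<in> A"
proof -
  obtain v where v: "(gp - gm, v) \<in> A"
    using gp_gm by blast
  moreover have "(gp - gm, snd (P - N)) \<in> adjoint_op S"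
    using adjoint_op_diff[OF P_adjoint N_adjoint] by simp
  ultimately have "v = snd (P - N)"
    using adjoint_op_unique[OF dense] A_subset_adjoint by blast
  then show ?thesis
    using v by simp
qed

lemma coord_self_adjoint:
  assumes "p \<in> A"
  shows "coord_minus p = - coord_plus p"
  using self_adjoint_boundary_form[OF self_adjoint assms P_minus_N_mem]
  unfolding boundary_form_simps coord_plus_def coord_minus_def by simp

text \<open>For \<open>p = (f, u)\<close>, solve \<open>(A - \<i>) x = u - \<i> f\<close>. Then \<open>S\<^sup>* - \<i>\<close> annihilates \<open>f - x\<close>, which is
  therefore a multiple of \<open>g\<^sub>+\<close>.\<close>

lemma adjoint_decomposition:
  assumes p: "p \<in> adjoint_op S"
  obtains a c where "a \<in> A" and "p = a + pscale c P"
proof -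
  obtain x where x: "(x, (snd p - \<i> *\<^sub>C fst p) + \<i> *\<^sub>C x) \<in> A"
    using self_adjoint_minus_nonreal_surj[OF self_adjoint, of \<i>] by auto
  define a where "a = (x, (snd p - \<i> *\<^sub>C fst p) + \<i> *\<^sub>C x)"
  have "p - a \<in> adjoint_op S"
    using adjoint_op_diff[OF p] A_subset_adjoint x a_def by blast
  moreover have pa: "p - a = (fst p - x, \<i> *\<^sub>C (fst p - x))"
    by (simp add: a_def prod_eq_iff cvs.scale_right_diff_distrib)
  ultimately have "fst p - x \<in> defect_space S \<i>"
    by (simp add: mem_defect_space)
  then obtain c where c: "fst p - x = c *\<^sub>C gp"
    using gp_spans by blast
  have "p - a = pscale c P"
    unfolding pa c pscale_def by (simp add: mult.commute)
  then have "p = a + pscale c P"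
    by (metis add.commute diff_add_cancel)
  moreover have "a \<in> A"
    using x by (simp only: a_def)
  ultimately show thesis
    using that by blast
qed

lemma Lagrange_identity:
  assumes p: "p \<in> adjoint_op S" and q: "q \<in> adjoint_op S"
  shows "boundary_form p q
    = 2 * \<i> * (coord_plus p * cnj (coord_plus q) - coord_minus p * cnj (coord_minus q))"
proof -
  obtain a c where a: "a \<in> A" and p_eq: "p = a + pscale c P"
    using adjoint_decomposition[OF p] .
  obtain b d where b: "b \<in> A" and q_eq: "q = b + pscale d P"
    using adjoint_decomposition[OF q] .
  have ab: "boundary_form a b = 0"
    by (rule self_adjoint_boundary_form[OF self_adjoint a b])
  have form_P: "boundary_form r P = 2 * \<i> * coord_plus r" for r
    by (simp add: coord_plus_def)
  have P_form: "boundary_form P r = 2 * \<i> * cnj (coord_plus r)" for r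
    using boundary_form_commute[of P r] by (simp add: form_P)
  show ?thesis
    unfolding p_eq q_eq boundary_form_simps coord_simps ab form_P P_form coord_defect
      coord_self_adjoint[OF a] coord_self_adjoint[OF b]
    by (simp add: algebra_simps)
qed

lemma eigenvector_norm:
  assumes "g \<in> defect_space S z"
  shows "Im z * (norm g)\<^sup>2
    = (cmod (coord_plus (g, z *\<^sub>C g)))\<^sup>2 - (cmod (coord_minus (g, z *\<^sub>C g)))\<^sup>2"
proof -
  have mem: "(g, z *\<^sub>C g) \<in> adjoint_op S"
    using assms by (simp add: mem_defect_space)
  have "2 * \<i> * of_real (Im z * (norm g)\<^sup>2) = 2 * \<i> * of_real
    ((cmod (coord_plus (g, z *\<^sub>C g)))\<^sup>2 - (cmod (coord_minus (g, z *\<^sub>C g)))\<^sup>2)"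
    using Lagrange_identity[OF mem mem] unfolding boundary_form_eigenvector
    by (simp add: complex_norm_square[symmetric])
  then show ?thesis
    by (simp only: mult_cancel_left of_real_eq_iff) simp
qed

lemma eigenvector_eq_0:
  assumes z: "Im z > 0" and g: "g \<in> defect_space S z"
    and le: "cmod (coord_plus (g, z *\<^sub>C g)) \<le> cmod (coord_minus (g, z *\<^sub>C g))"
  shows "g = 0"
proof -
  have "Im z * (norm g)\<^sup>2 \<le> 0"
    unfolding eigenvector_norm[OF g] using le by (simp add: power_mono)
  then show ?thesis
    using z by (simp add: mult_le_0_iff)
qed

section \<open>The Livsic function\<close>

text \<open>The combination of \<open>g\<close> and \<open>h\<close> with first coordinate \<open>0\<close> vanishes, so its second
  coordinate vanishes too. This makes the Livsic function independent of the chosen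
  eigenvector.\<close>

lemma eigenvector_coord_ratio:
  assumes z: "Im z > 0" and g: "g \<in> defect_space S z" and h: "h \<in> defect_space S z"
  shows "coord_minus (h, z *\<^sub>C h) * coord_plus (g, z *\<^sub>C g)
    = coord_minus (g, z *\<^sub>C g) * coord_plus (h, z *\<^sub>C h)"
proof -
  let ?g = "(g, z *\<^sub>C g)" and ?h = "(h, z *\<^sub>C h)"
  define k where "k = coord_plus ?g *\<^sub>C h - coord_plus ?h *\<^sub>C g"
  have k: "(k, z *\<^sub>C k) = pscale (coord_plus ?g) ?h - pscale (coord_plus ?h) ?g"
    by (simp add: k_def pscale_def cvs.scale_right_diff_distrib mult.commute)
  have "k \<in> defect_space S z"
    using g h unfolding mem_defect_space k by (intro adjoint_op_diff adjoint_op_pscale)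
  moreover have "coord_plus (k, z *\<^sub>C k) = 0"
    unfolding k coord_simps by simp
  ultimately have "k = 0"
    using eigenvector_eq_0[OF z] by simp
  then have "coord_minus (k, z *\<^sub>C k) = 0"
    by (simp add: coord_minus_def boundary_form_def cinner_zero_left)
  then show ?thesis
    unfolding k coord_simps by (simp add: mult.commute)
qed

text \<open>Any other admissible pair is \<open>a g\<^sub>+\<close>, \<open>b g\<^sub>-\<close>. Its difference lies in the domain of \<open>A\<close>, where
  the coordinates are opposite, so \<open>a = b\<close> and this factor cancels in the quotient.\<close>

lemma livsic_function_eq:
  assumes z: "Im z > 0" and g: "g \<in> defect_space S z" and g0: "g \<noteq> 0"
  shows "livsic_function S A z = - coord_minus (g, z *\<^sub>C g) / coord_plus (g, z *\<^sub>C g)"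
proof -
  have zi: "z + \<i> \<noteq> 0"
    using z by (auto simp: complex_eq_iff)
  have cancel: "- (- a * c / (2 * \<i>)) / (b * d / (2 * \<i>)) = a / b * (c / d)" for a b c d :: complex
    by simp
  have nz: "coord_plus (h, z *\<^sub>C h) \<noteq> 0" if "h \<in> defect_space S z" "h \<noteq> 0" for h
    using eigenvector_eq_0[OF z that(1)] that(2) by auto
  have ratio: "(z - \<i>) / (z + \<i>) * (cinner h gm / cinner h gp)
      = - coord_minus (g, z *\<^sub>C g) / coord_plus (g, z *\<^sub>C g)"
    if h: "h \<in> defect_space S z" "h \<noteq> 0" for h
  proof -
    have "(z - \<i>) / (z + \<i>) * (cinner h gm / cinner h gp)
        = - coord_minus (h, z *\<^sub>C h) / coord_plus (h, z *\<^sub>C h)"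
      unfolding coord_eigenvector by (simp only: cancel)
    also have "\<dots> = - coord_minus (g, z *\<^sub>C g) / coord_plus (g, z *\<^sub>C g)"
      using eigenvector_coord_ratio[OF z g h(1)] nz[OF h] nz[OF g g0]
      by (simp add: frac_eq_eq)
    finally show ?thesis .
  qed
  show ?thesis
    unfolding livsic_function_def
  proof (rule the_equality)
    show "\<exists>gp gm gz. gp \<in> defect_space S \<i> \<and> norm gp = 1 \<and>
      gm \<in> defect_space S (- \<i>) \<and> norm gm = 1 \<and> gp - gm \<in> Domain A \<and>
      gz \<in> defect_space S z \<and> gz \<noteq> 0 \<and>
      - coord_minus (g, z *\<^sub>C g) / coord_plus (g, z *\<^sub>C g)
        = (z - \<i>) / (z + \<i>) * (cinner gz gm / cinner gz gp)"
      using gp norm_gp gm norm_gm gp_gm g g0 ratio[OF g g0] by metis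
  next
    fix w
    assume "\<exists>gp gm gz. gp \<in> defect_space S \<i> \<and> norm gp = 1 \<and>
      gm \<in> defect_space S (- \<i>) \<and> norm gm = 1 \<and> gp - gm \<in> Domain A \<and>
      gz \<in> defect_space S z \<and> gz \<noteq> 0 \<and>
      w = (z - \<i>) / (z + \<i>) * (cinner gz gm / cinner gz gp)"
    then obtain gp' gm' h where gp': "gp' \<in> defect_space S \<i>" "norm gp' = 1"
      and gm': "gm' \<in> defect_space S (- \<i>)" and dom: "gp' - gm' \<in> Domain A"
      and h: "h \<in> defect_space S z" "h \<noteq> 0"
      and w: "w = (z - \<i>) / (z + \<i>) * (cinner h gm' / cinner h gp')"
      by blast
    obtain a b where a: "gp' = a *\<^sub>C gp" and b: "gm' = b *\<^sub>C gm"
      using gp_spans[OF gp'(1)] gm_spans[OF gm'] by blast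
    have "a \<noteq> 0"
      using gp'(2) a by auto
    obtain v where v: "(gp' - gm', v) \<in> A"
      using dom by blast
    have diff: "pscale a P - pscale b N = (gp' - gm', snd (pscale a P - pscale b N))"
      by (simp add: pscale_def a b)
    have "pscale a P - pscale b N \<in> adjoint_op S"
      by (intro adjoint_op_diff adjoint_op_pscale P_adjoint N_adjoint)
    then have "v = snd (pscale a P - pscale b N)"
      using adjoint_op_unique[OF dense] A_subset_adjoint v diff by (metis subsetD)
    then have "pscale a P - pscale b N \<in> A"
      using v diff by simp
    from coord_self_adjoint[OF this] have "a = b"
      unfolding coord_simps coord_defect by simp
    then have "w = (z - \<i>) / (z + \<i>) * (cinner h gm / cinner h gp)"
      using \<open>a \<noteq> 0\<close> unfolding w a b by (simp add: cinner_simps)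
    then show "w = - coord_minus (g, z *\<^sub>C g) / coord_plus (g, z *\<^sub>C g)"
      using ratio[OF h] by simp
  qed
qed

end

section \<open>The Weyl-Titchmarsh function\<close>

locale deficiency_one_dissipative = deficiency_one_extension +
  fixes T :: "'a unbounded_op" and \<kappa> :: complex
  assumes symmetric: "symmetric_op S" and dissipative: "dissipative_op T"
    and T_extends: "S \<subseteq> T"
    and gp_kappa_gm: "gp - \<kappa> *\<^sub>C gm \<in> Domain T" and kappa: "cmod \<kappa> < 1"
begin

lemma T_subset_adjoint: "T \<subseteq> adjoint_op S"
  by (rule dissipative_extension_subset_adjoint[OF symmetric dissipative T_extends])

lemma P_minus_kappa_N_mem: "P - pscale \<kappa> N \<in> T"
proof -
  obtain v where v: "(gp - \<kappa> *\<^sub>C gm, v) \<in> T"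
    using gp_kappa_gm by blast
  have diff: "P - pscale \<kappa> N = (gp - \<kappa> *\<^sub>C gm, snd (P - pscale \<kappa> N))"
    by (simp add: pscale_def)
  have "P - pscale \<kappa> N \<in> adjoint_op S"
    by (intro adjoint_op_diff adjoint_op_pscale P_adjoint N_adjoint)
  then have "v = snd (P - pscale \<kappa> N)"
    using adjoint_op_unique[OF dense] T_subset_adjoint v diff by (metis subsetD)
  then show ?thesis
    using v diff by simp
qed

text \<open>Subtracting a multiple of \<open>P - \<kappa> N\<close> gives an element of \<open>T\<close> with first coordinate \<open>0\<close>. By
  the Lagrange identity the form there is \<open>- 2\<i> |\<beta>|\<^sup>2\<close>, and dissipativity forces
  \<open>\<beta> = 0\<close>.\<close>

lemma coord_dissipative:
  assumes p: "p \<in> T"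
  shows "coord_minus p = - \<kappa> * coord_plus p"
proof -
  define q where "q = p + pscale (- coord_plus p) (P - pscale \<kappa> N)"
  have q: "q \<in> T"
    using dissipative p P_minus_kappa_N_mem unfolding dissipative_op_def q_def
    by (blast intro: linear_op_add linear_op_pscale)
  then have q_adj: "q \<in> adjoint_op S"
    using T_subset_adjoint by blast
  have plus: "coord_plus q = 0"
    unfolding q_def coord_simps coord_defect by simp
  have "0 \<le> Im (boundary_form q q)"
    using dissipative q by (cases q) (auto simp: dissipative_op_def Im_boundary_form_self)
  also have "Im (boundary_form q q) = - 2 * (cmod (coord_minus q))\<^sup>2"
    unfolding Lagrange_identity[OF q_adj q_adj] plus cmod_power2
    by (simp add: power2_eq_square)
  finally have "coord_minus q = 0"
    by simp
  then show ?thesis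
    unfolding q_def coord_simps coord_defect by (simp add: algebra_simps add_eq_0_iff2)
qed

lemma mem_adjoint_dissipative:
  "q \<in> adjoint_op T \<longleftrightarrow> q \<in> adjoint_op S \<and> coord_plus q = - cnj \<kappa> * coord_minus q"
proof
  assume q: "q \<in> adjoint_op T"
  then have qS: "q \<in> adjoint_op S"
    using adjoint_op_antimono[OF T_extends] by blast
  have "P - pscale \<kappa> N \<in> adjoint_op S"
    using P_minus_kappa_N_mem T_subset_adjoint by blast
  from Lagrange_identity[OF this qS]
  have "cnj (coord_plus q) + \<kappa> * cnj (coord_minus q) = 0"
    using q P_minus_kappa_N_mem unfolding mem_adjoint_op coord_simps coord_defect by simp
  then have "cnj (cnj (coord_plus q) + \<kappa> * cnj (coord_minus q)) = cnj 0"
    by simp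
  then show "q \<in> adjoint_op S \<and> coord_plus q = - cnj \<kappa> * coord_minus q"
    using qS by (simp add: add_eq_0_iff2)
next
  assume q: "q \<in> adjoint_op S \<and> coord_plus q = - cnj \<kappa> * coord_minus q"
  have "boundary_form p q = 0" if p: "p \<in> T" for p
  proof -
    have "p \<in> adjoint_op S" and "q \<in> adjoint_op S"
      using p q T_subset_adjoint by blast+
    from Lagrange_identity[OF this] show ?thesis
      using q unfolding coord_dissipative[OF p] by simp
  qed
  then show "q \<in> adjoint_op T"
    by (simp add: mem_adjoint_op)
qed

lemma adjoint_no_eigenvector:
  assumes z: "Im z > 0" and d: "(d, z *\<^sub>C d) \<in> adjoint_op T"
  shows "d = 0"
proof (rule eigenvector_eq_0[OF z])
  have "coord_plus (d, z *\<^sub>C d) = - cnj \<kappa> * coord_minus (d, z *\<^sub>C d)"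
    using d unfolding mem_adjoint_dissipative by blast
  then have "cmod (coord_plus (d, z *\<^sub>C d)) = cmod \<kappa> * cmod (coord_minus (d, z *\<^sub>C d))"
    by (simp add: norm_mult)
  then show "cmod (coord_plus (d, z *\<^sub>C d)) \<le> cmod (coord_minus (d, z *\<^sub>C d))"
    using kappa by (simp add: mult_left_le_one_le)
  show "d \<in> defect_space S z"
    using d unfolding mem_adjoint_dissipative mem_defect_space by blast
qed

text \<open>Start from \<open>x = (A - z)\<^sup>-\<^sup>1 g\<^sub>+\<close>, which solves the equation in \<open>S\<^sup>*\<close>. Adding a multiple of the
  eigenvector \<open>g = g\<^sub>+ + (z - \<i>) x\<close> of \<open>S\<^sup>*\<close> at \<open>z\<close> keeps it a solution, and a suitable multiple
  achieves the boundary condition of \<open>T\<^sup>*\<close>, since \<open>g\<close> itself violates it.\<close>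

lemma adjoint_resolvent_gp:
  assumes z: "Im z > 0"
  obtains x where "(x, gp + z *\<^sub>C x) \<in> adjoint_op T"
proof -
  obtain x where x: "(x, gp + z *\<^sub>C x) \<in> A"
    using self_adjoint_minus_nonreal_surj[OF self_adjoint, of z gp] z by auto
  define g where "g = gp + (z - \<i>) *\<^sub>C x"
  let ?x = "(x, gp + z *\<^sub>C x)" and ?g = "(g, z *\<^sub>C g)"
  have x_adj: "?x \<in> adjoint_op S"
    using x A_subset_adjoint by blast
  have g_eq: "?g = P + pscale (z - \<i>) ?x"
    by (simp add: g_def pscale_def cvs.scale_right_distrib cvs.scale_left_diff_distrib
        algebra_simps)
  have g_adj: "?g \<in> adjoint_op S"
    unfolding g_eq by (intro adjoint_op_add adjoint_op_pscale P_adjoint x_adj)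
  \<comment> \<open>The defect of \<open>g\<close> in the boundary condition. If it vanished, \<open>g\<close> would be an eigenvector
    of \<open>T\<^sup>*\<close>, hence \<open>0\<close>; but the sum of the coordinates is \<open>0\<close> on \<open>A\<close> and \<open>1\<close> at \<open>P\<close>.\<close>
  define e where "e = coord_plus ?g + cnj \<kappa> * coord_minus ?g"
  have "e \<noteq> 0"
  proof
    assume "e = 0"
    then have "?g \<in> adjoint_op T"
      using g_adj unfolding mem_adjoint_dissipative e_def by (simp add: add_eq_0_iff2)
    then have g0: "g = 0"
      by (rule adjoint_no_eigenvector[OF z])
    then have "0 = coord_plus ?g + coord_minus ?g"
      by (simp add: coord_plus_def coord_minus_def boundary_form_def cinner_zero_left)
    also have "\<dots> = 1"
      unfolding g_eq coord_simps coord_defect coord_self_adjoint[OF x] by simp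
    finally show False by simp
  qed
  define c where "c = - (coord_plus ?x + cnj \<kappa> * coord_minus ?x) / e"
  define y where "y = x + c *\<^sub>C g"
  have y_eq: "(y, gp + z *\<^sub>C y) = ?x + pscale c ?g"
    by (simp add: y_def pscale_def cvs.scale_right_distrib algebra_simps)
  have "c * e = - (coord_plus ?x + cnj \<kappa> * coord_minus ?x)"
    using \<open>e \<noteq> 0\<close> by (simp add: c_def)
  then have "coord_plus (y, gp + z *\<^sub>C y) + cnj \<kappa> * coord_minus (y, gp + z *\<^sub>C y) = 0"
    unfolding y_eq coord_simps e_def by algebra
  then have "coord_plus (y, gp + z *\<^sub>C y) = - cnj \<kappa> * coord_minus (y, gp + z *\<^sub>C y)"
    by (simp add: add_eq_0_iff2)
  moreover have "(y, gp + z *\<^sub>C y) \<in> adjoint_op S"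
    unfolding y_eq by (intro adjoint_op_add adjoint_op_pscale x_adj g_adj)
  ultimately show thesis
    using that mem_adjoint_dissipative by blast
qed

text \<open>The vector \<open>x\<close> is the value of the resolvent of \<open>T\<^sup>*\<close> at \<open>g\<^sub>+\<close>. Another unit vector in the
  defect space is \<open>a g\<^sub>+\<close> with \<open>|a| = 1\<close>, and the factor \<open>a cnj a\<close> leaves the quadratic form
  unchanged.\<close>

lemma weyl_titchmarsh_function_eq:
  assumes z: "Im z > 0" and x: "(x, gp + z *\<^sub>C x) \<in> adjoint_op T"
  shows "weyl_titchmarsh_function S T z = \<i> + 2 * \<i> * (z - \<i>) * coord_plus (x, gp + z *\<^sub>C x)"
proof -
  define R where "R = (op_affine 1 (adjoint_op T) (- z))\<inverse> O op_affine z (adjoint_op T) 1"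
  have mem_R: "(g, y) \<in> R \<longleftrightarrow> (\<exists>x. (x, g + z *\<^sub>C x) \<in> adjoint_op T \<and> y = z *\<^sub>C (g + z *\<^sub>C x) + x)"
    for g y
  proof
    assume "(g, y) \<in> R"
    then obtain x u u' where u: "(x, u) \<in> adjoint_op T" "g = u - z *\<^sub>C x"
      and u': "(x, u') \<in> adjoint_op T" "y = z *\<^sub>C u' + x"
      by (auto simp: R_def op_affine_def)
    have "u = u'"
      using u(1) u'(1) adjoint_op_antimono[OF T_extends] adjoint_op_unique[OF dense] by blast
    then have "(x, g + z *\<^sub>C x) \<in> adjoint_op T \<and> y = z *\<^sub>C (g + z *\<^sub>C x) + x"
      using u u' by simp
    then show "\<exists>x. (x, g + z *\<^sub>C x) \<in> adjoint_op T \<and> y = z *\<^sub>C (g + z *\<^sub>C x) + x" ..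
  next
    assume "\<exists>x. (x, g + z *\<^sub>C x) \<in> adjoint_op T \<and> y = z *\<^sub>C (g + z *\<^sub>C x) + x"
    then obtain x where "(x, g + z *\<^sub>C x) \<in> adjoint_op T" "y = z *\<^sub>C (g + z *\<^sub>C x) + x"
      by blast
    then have "(x, g) \<in> op_affine 1 (adjoint_op T) (- z)"
      and "(x, y) \<in> op_affine z (adjoint_op T) 1"
      unfolding op_affine_def by force+
    then show "(g, y) \<in> R"
      unfolding R_def by blast
  qed
  have R_unit: "op_apply R (a *\<^sub>C gp) = a *\<^sub>C (z *\<^sub>C (gp + z *\<^sub>C x) + x)" for a
    unfolding op_apply_def
  proof (rule the_equality)
    have ax: "pscale a (x, gp + z *\<^sub>C x) = (a *\<^sub>C x, a *\<^sub>C gp + z *\<^sub>C (a *\<^sub>C x))"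
      by (simp add: pscale_def cvs.scale_right_distrib mult.commute)
    have ax_mem: "(a *\<^sub>C x, a *\<^sub>C gp + z *\<^sub>C (a *\<^sub>C x)) \<in> adjoint_op T"
      using adjoint_op_pscale[OF x, of a] by (simp only: ax)
    moreover have ay: "a *\<^sub>C (z *\<^sub>C (gp + z *\<^sub>C x) + x)
        = z *\<^sub>C (a *\<^sub>C gp + z *\<^sub>C (a *\<^sub>C x)) + a *\<^sub>C x"
      by (simp add: cvs.scale_right_distrib mult_ac)
    ultimately show "(a *\<^sub>C gp, a *\<^sub>C (z *\<^sub>C (gp + z *\<^sub>C x) + x)) \<in> R"
      unfolding mem_R by blast
    fix y assume "(a *\<^sub>C gp, y) \<in> R"
    then obtain x' where x': "(x', a *\<^sub>C gp + z *\<^sub>C x') \<in> adjoint_op T"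
      and y: "y = z *\<^sub>C (a *\<^sub>C gp + z *\<^sub>C x') + x'"
      unfolding mem_R by blast
    have "(x' - a *\<^sub>C x, z *\<^sub>C (x' - a *\<^sub>C x)) \<in> adjoint_op T"
      using adjoint_op_diff[OF x' ax_mem] by (simp add: cvs.scale_right_diff_distrib)
    then have "x' = a *\<^sub>C x"
      using adjoint_no_eigenvector[OF z] by fastforce
    then show "y = a *\<^sub>C (z *\<^sub>C (gp + z *\<^sub>C x) + x)"
      unfolding y ay by simp
  qed
  have gpgp: "cinner gp gp = 1"
    using norm_gp by (simp add: cinner_self)
  have inner_gp: "cinner (z *\<^sub>C (gp + z *\<^sub>C x) + x) gp
      = \<i> + 2 * \<i> * (z - \<i>) * coord_plus (x, gp + z *\<^sub>C x)"
  proof -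
    have "2 * \<i> * coord_plus (x, gp + z *\<^sub>C x) = boundary_form (x, gp + z *\<^sub>C x) P"
      by (simp add: coord_plus_def)
    also have "\<dots> = 1 + (z + \<i>) * cinner x gp"
      by (simp add: boundary_form_def cinner_simps gpgp algebra_simps)
    finally have "2 * \<i> * coord_plus (x, gp + z *\<^sub>C x) = 1 + (z + \<i>) * cinner x gp" .
    then have "\<i> + 2 * \<i> * (z - \<i>) * coord_plus (x, gp + z *\<^sub>C x)
        = \<i> + (z - \<i>) * (1 + (z + \<i>) * cinner x gp)"
      by (metis mult.assoc mult.commute)
    also have "\<dots> = cinner (z *\<^sub>C (gp + z *\<^sub>C x) + x) gp"
      by (simp add: cinner_simps gpgp algebra_simps)
    finally show ?thesis by simp
  qed
  show ?thesis
    unfolding weyl_titchmarsh_function_def R_def[symmetric]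
  proof (rule the_equality)
    show "\<exists>g. g \<in> defect_space S \<i> \<and> norm g = 1 \<and>
      \<i> + 2 * \<i> * (z - \<i>) * coord_plus (x, gp + z *\<^sub>C x) = cinner (op_apply R g) g"
      using gp norm_gp inner_gp R_unit[of 1] by (intro exI[of _ gp]) simp
    fix w assume "\<exists>g. g \<in> defect_space S \<i> \<and> norm g = 1 \<and> w = cinner (op_apply R g) g"
    then obtain a where a: "norm (a *\<^sub>C gp) = 1"
      and w: "w = cinner (op_apply R (a *\<^sub>C gp)) (a *\<^sub>C gp)"
      using gp_spans by metis
    have "cnj a * a = 1"
      using a norm_gp
      by (simp add: norm_scaleC mult.commute[of "cnj a"] complex_norm_square[symmetric])
    then have "w = cinner (z *\<^sub>C (gp + z *\<^sub>C x) + x) gp"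
      unfolding w R_unit cinner_scaleC_left cinner_scaleC_right
      by (simp add: mult.assoc[symmetric])
    then show "w = \<i> + 2 * \<i> * (z - \<i>) * coord_plus (x, gp + z *\<^sub>C x)"
      by (simp only: inner_gp)
  qed
qed

lemma livsic_weyl_titchmarsh:
  assumes z: "Im z > 0"
  shows "cnj \<kappa> * livsic_function S A z
    = (weyl_titchmarsh_function S T z - \<i>) / (weyl_titchmarsh_function S T z + \<i>)"
proof -
  obtain x where x: "(x, gp + z *\<^sub>C x) \<in> adjoint_op T"
    using adjoint_resolvent_gp[OF z] .
  let ?x = "(x, gp + z *\<^sub>C x)"
  have x_adj: "?x \<in> adjoint_op S" and x_coord: "coord_plus ?x = - cnj \<kappa> * coord_minus ?x"
    using x unfolding mem_adjoint_dissipative by blast+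
  define g where "g = gp + (z - \<i>) *\<^sub>C x"
  have g_eq: "(g, z *\<^sub>C g) = P + pscale (z - \<i>) ?x"
    by (simp add: g_def pscale_def cvs.scale_right_distrib cvs.scale_left_diff_distrib
        algebra_simps)
  have g_mem: "g \<in> defect_space S z"
    unfolding mem_defect_space g_eq
    by (intro adjoint_op_add adjoint_op_pscale P_adjoint x_adj)
  have plus: "coord_plus (g, z *\<^sub>C g) = 1 + (z - \<i>) * coord_plus ?x"
    and minus: "coord_minus (g, z *\<^sub>C g) = (z - \<i>) * coord_minus ?x"
    unfolding g_eq coord_simps coord_defect by simp_all
  \<comment> \<open>Otherwise the boundary condition of \<open>T\<^sup>*\<close>, satisfied by \<open>x\<close>, would hold at \<open>P\<close>.\<close>
  have "g \<noteq> 0"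
  proof
    assume "g = 0"
    then have "coord_plus (g, z *\<^sub>C g) + cnj \<kappa> * coord_minus (g, z *\<^sub>C g) = 0"
      by (simp add: coord_plus_def coord_minus_def boundary_form_def cinner_zero_left)
    then show False
      unfolding plus minus x_coord by (simp add: algebra_simps)
  qed
  then have "livsic_function S A z = - coord_minus (g, z *\<^sub>C g) / coord_plus (g, z *\<^sub>C g)"
    by (rule livsic_function_eq[OF z g_mem])
  then have "cnj \<kappa> * livsic_function S A z
      = (z - \<i>) * coord_plus ?x / (1 + (z - \<i>) * coord_plus ?x)"
    unfolding plus minus by (simp add: x_coord)
  also have "\<dots> = (2 * \<i> * ((z - \<i>) * coord_plus ?x)) / (2 * \<i> * (1 + (z - \<i>) * coord_plus ?x))"
    by (rule mult_divide_mult_cancel_left[symmetric]) simp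
  also have "\<dots> = (weyl_titchmarsh_function S T z - \<i>) / (weyl_titchmarsh_function S T z + \<i>)"
    unfolding weyl_titchmarsh_function_eq[OF z x] by (simp add: algebra_simps)
  finally show ?thesis .
qed

end

theorem theorem3p2:
  fixes Adot A Ahat :: "'a::complex_hilbert_space unbounded_op"
    and gp gm :: 'a and \<kappa> z :: complex
  assumes "symmetric_op Adot" and "densely_defined Adot" and "closed Adot"
    and "deficiency_indices Adot = (1, 1)"
    and "self_adjoint_op A" and "Adot \<subseteq> A"
    and "maximal_dissipative_extension Adot Ahat" and "Ahat \<noteq> adjoint_op Ahat"
    and "gp \<in> defect_space Adot \<i>" and "norm gp = 1"
    and "gm \<in> defect_space Adot (- \<i>)" and "norm gm = 1"
    and "gp - gm \<in> Domain A"
    and "gp - \<kappa> *\<^sub>C gm \<in> Domain Ahat" and "cmod \<kappa> < 1"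
    and "Im z > 0"
  shows "cnj \<kappa> * livsic_function Adot A z =
    (weyl_titchmarsh_function Adot Ahat z - \<i>) / (weyl_titchmarsh_function Adot Ahat z + \<i>)"
proof -
  have dim: "cvs.dim (defect_space Adot \<i>) = 1" "cvs.dim (defect_space Adot (- \<i>)) = 1"
    using assms(4) by (simp_all add: deficiency_indices_def)
  have nz: "gp \<noteq> 0" "gm \<noteq> 0"
    using assms(10,12) by auto
  interpret deficiency_one_dissipative Adot A gp gm Ahat \<kappa>
  proof
    show "\<exists>c. g = c *\<^sub>C gp" if "g \<in> defect_space Adot \<i>" for g
      by (rule one_dimensional_multiple[OF dim(1) assms(9) nz(1) that])
    show "\<exists>c. g = c *\<^sub>C gm" if "g \<in> defect_space Adot (- \<i>)" for g
      by (rule one_dimensional_multiple[OF dim(2) assms(11) nz(2) that])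
  qed (use assms in \<open>simp_all add: maximal_dissipative_extension_def\<close>)
  show ?thesis
    by (rule livsic_weyl_titchmarsh[OF assms(16)])
qed

end
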